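(* Let $\mathbb{K}$ be a field and let $(\Omega,\cdot)$ be a commutative semigroup. For any $\lambda\in\mathbb{K}$, $(\mathcal{T}_\Omega,\mathbin{\sqcup\!\sqcup}^T_\lambda,\Delta)$ is a commutative, non-associative, non-cocommutative and coassociative bialgebra. (If $\lambda=0$, $\Omega$ may be any set, without a semigroup structure.)
   Context: Rooted forests are finite, non-planar (considered up to isomorphism), with vertices decorated by $\Omega$; edges are oriented away from the roots. $\mathcal{F}_\Omega$ denotes the set of ($\Omega$-decorated) rooted forests and also the $\mathbb{K}$-vector space freely generated by it; $\mathcal{T}_\Omega$ is the subspace spanned by rooted trees (connected rooted forests), including the empty tree $\emptyset$. $|F|$ is the number of vertices of $F$. Concatenation (disjoint union) $F_1\cdots F_k$ of forests is commutative with unit $\emptyset$. For $a\in\Omega$, the linear grafting operator $B_+^a:\mathcal{F}_\Omega\to\mathcal{T}_\Omega$ sends a forest $T_1\cdots T_k$ to the tree obtained by adding a new root decorated by $a$, linked to the root of each $T_i$; $B_+^a(\emptyset)$ is the one-vertex tree decorated by $a$. The $\lambda$-shuffle $\mathbin{\sqcup\!\sqcup}^T_\lambda$ is the bilinear product on $\mathcal{F}_\Omega$ defined recursively on $|F|+|F'|$ by: $F\mathbin{\sqcup\!\sqcup}^T_\lambda\emptyset=\emptyset\mathbin{\sqcup\!\sqcup}^T_\lambda F=F$; if $F=T_1\cdots T_k$ and $F'=t_1\cdots t_n$ with all $T_i,t_j$ non-empty trees, $k,n\ge1$ and $k+n\geq 3$, $$F\mathbin{\sqcup\!\sqcup}^T_\lambda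 F'=\frac1{kn}\sum_{i=1}^k\sum_{j=1}^n (T_i\mathbin{\sqcup\!\sqcup}^T_\lambda t_j)\,T_1\cdots\widehat{T_i}\cdots T_k\,t_1\cdots\widehat{t_j}\cdots t_n$$ (hats denote omission); and for non-empty trees $T=B_+^a(f)$, $T'=B_+^{a'}(f')$, $$T\mathbin{\sqcup\!\sqcup}^T_\lambda T'=B_+^a(f\mathbin{\sqcup\!\sqcup}^T_\lambda T')+B_+^{a'}(T\mathbin{\sqcup\!\sqcup}^T_\lambda f')+\lambda B_+^{a\cdot a'}(f\mathbin{\sqcup\!\sqcup}^T_\lambda f').$$ The shuffle of two trees is a linear combination of trees, so $\mathbin{\sqcup\!\sqcup}^T_\lambda$ restricts to $\mathcal{T}_\Omega$, with unit $\emptyset$. The coproduct $\Delta:\mathcal{T}_\Omega\to\mathcal{T}_\Omega\otimes\mathcal{T}_\Omega$ is the linear map defined inductively by $\Delta(\emptyset)=\emptyset\otimes\emptyset$; $\Delta(B_+^a(t))=(B_+^a\otimes \mathrm{Id})\Delta(t)+\emptyset\otimes B_+^a(t)$ if $t$ is a (possibly empty) tree; $\Delta(B_+^a(f))=\emptyset\otimes B_+^a(f)$ if $f$ is a non-connected forest (at least two non-empty trees). The counit is the linear map $\varepsilon:\mathcal{T}_\Omega\to\mathbb{K}$ with $\varepsilon(\emptyset)=1$ and $\varepsilon(T)=0$ for $T$ a non-empty tree. For a (not necessarily associative) algebra $(B,m)$, a bialgebra structure consists of a coassociative coproduct $\Delta:B\to B\otimes B$ and a counit $\varepsilon:B\to\mathbb{K}$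 such that $(\varepsilon\otimes \mathrm{Id})\Delta$ and $(\mathrm{Id}\otimes\varepsilon)\Delta$ are the canonical isomorphisms $B\simeq\mathbb{K}\otimes B$, $B\simeq B\otimes\mathbb{K}$, and $\Delta\circ m=(m\otimes m)\circ\tau_{23}\circ(\Delta\otimes\Delta)$, where $\tau_{23}(a\otimes b\otimes c\otimes d)=a\otimes c\otimes b\otimes d$ (together with compatibility of the unit with $\Delta$ and of the counit with $m$).
   Formalization: The axiom that (Id⊗ε)Δ is the canonical isomorphism is dropped, as it fails: for T=B_+^a(f), f non-connected, Δ(T)=∅⊗T, so (Id⊗ε)Δ(T)=0≠T. Ω is taken non-empty, and 1/(kn) is read as 0 when the characteristic of K divides kn. *)

theory Defs
  imports "HOL-Library.Poly_Mapping" "HOL-Library.Multiset"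
begin

section \<open>Free vector spaces and their tensor products\<close>

text \<open>
  The \<open>'k\<close>-vector space with basis \<open>'b\<close> is \<open>'b \<Rightarrow>\<^sub>0 'k\<close>; its basis vectors are \<open>bvec b\<close>.
  The tensor product of the spaces with bases \<open>'b\<close> and \<open>'c\<close> is the space with basis \<open>'b \<times> 'c\<close>,
  where \<open>b \<otimes> c\<close> is \<open>bvec (b, c)\<close>. Linear maps out of these spaces are described by their
  values on the basis.
\<close>

abbreviation bvec :: "'b \<Rightarrow> ('b \<Rightarrow>\<^sub>0 'k::field)" where
  "bvec b \<equiv> Poly_Mapping.single b 1"

definition scale :: "'k \<Rightarrow> ('b \<Rightarrow>\<^sub>0 'k) \<Rightarrow> ('b \<Rightarrow>\<^sub>0 'k::field)" where
  "scale c x = Poly_Mapping.map ((*) c) x"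

definition linext :: "('b \<Rightarrow> ('c \<Rightarrow>\<^sub>0 'k)) \<Rightarrow> ('b \<Rightarrow>\<^sub>0 'k) \<Rightarrow> ('c \<Rightarrow>\<^sub>0 'k::field)" where
  "linext f x = (\<Sum>b\<in>Poly_Mapping.keys x. scale (Poly_Mapping.lookup x b) (f b))"

definition span_on :: "'b set \<Rightarrow> ('b \<Rightarrow>\<^sub>0 'k::field) set" where
  "span_on X = {x. Poly_Mapping.keys x \<subseteq> X}"

definition linear_on :: "'b set \<Rightarrow> (('b \<Rightarrow>\<^sub>0 'k) \<Rightarrow> ('c \<Rightarrow>\<^sub>0 'k::field)) \<Rightarrow> bool" where
  "linear_on X f \<longleftrightarrow>
     (\<forall>x\<in>span_on X. \<forall>y\<in>span_on X. f (x + y) = f x + f y) \<and>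
     (\<forall>c. \<forall>x\<in>span_on X. f (scale c x) = scale c (f x))"

definition functional_on :: "'b set \<Rightarrow> (('b \<Rightarrow>\<^sub>0 'k) \<Rightarrow> 'k::field) \<Rightarrow> bool" where
  "functional_on X f \<longleftrightarrow>
     (\<forall>x\<in>span_on X. \<forall>y\<in>span_on X. f (x + y) = f x + f y) \<and>
     (\<forall>c. \<forall>x\<in>span_on X. f (scale c x) = c * f x)"

definition tensor :: "('b \<Rightarrow>\<^sub>0 'k) \<Rightarrow> ('c \<Rightarrow>\<^sub>0 'k) \<Rightarrow> ('b \<times> 'c \<Rightarrow>\<^sub>0 'k::field)" where
  "tensor x y = linext (\<lambda>b. linext (\<lambda>c. bvec (b, c)) y) x"

definition tensor_map ::
  "(('b \<Rightarrow>\<^sub>0 'k) \<Rightarrow> ('d \<Rightarrow>\<^sub>0 'k)) \<Rightarrow> (('c \<Rightarrow>\<^sub>0 'k) \<Rightarrow> ('e \<Rightarrow>\<^sub>0 'k)) \<Rightarrow>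
   ('b \<times> 'c \<Rightarrow>\<^sub>0 'k) \<Rightarrow> ('d \<times> 'e \<Rightarrow>\<^sub>0 'k::field)" where
  "tensor_map f g = linext (\<lambda>(b, c). tensor (f (bvec b)) (g (bvec c)))"

text \<open>\<open>f \<otimes> Id\<close> and \<open>Id \<otimes> f\<close> for a linear form \<open>f\<close>, followed by the canonical isomorphisms
  from \<open>K \<otimes> B\<close> and \<open>B \<otimes> K\<close> to \<open>B\<close>.\<close>

definition form_tensor_id ::
  "(('b \<Rightarrow>\<^sub>0 'k) \<Rightarrow> 'k) \<Rightarrow> ('b \<times> 'c \<Rightarrow>\<^sub>0 'k) \<Rightarrow> ('c \<Rightarrow>\<^sub>0 'k::field)" where
  "form_tensor_id f = linext (\<lambda>(b, c). scale (f (bvec b)) (bvec c))"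

definition id_tensor_form ::
  "(('c \<Rightarrow>\<^sub>0 'k) \<Rightarrow> 'k) \<Rightarrow> ('b \<times> 'c \<Rightarrow>\<^sub>0 'k) \<Rightarrow> ('b \<Rightarrow>\<^sub>0 'k::field)" where
  "id_tensor_form f = linext (\<lambda>(b, c). scale (f (bvec c)) (bvec b))"

definition tensor_assoc :: "(('b \<times> 'c) \<times> 'd \<Rightarrow>\<^sub>0 'k) \<Rightarrow> ('b \<times> ('c \<times> 'd) \<Rightarrow>\<^sub>0 'k::field)" where
  "tensor_assoc = linext (\<lambda>((b, c), d). bvec (b, (c, d)))"

definition tensor_flip :: "('b \<times> 'c \<Rightarrow>\<^sub>0 'k) \<Rightarrow> ('c \<times> 'b \<Rightarrow>\<^sub>0 'k::field)" where
  "tensor_flip = linext (\<lambda>(b, c). bvec (c, b))"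

definition tau23 ::
  "(('b \<times> 'c) \<times> ('d \<times> 'e) \<Rightarrow>\<^sub>0 'k) \<Rightarrow> (('b \<times> 'd) \<times> ('c \<times> 'e) \<Rightarrow>\<^sub>0 'k::field)" where
  "tau23 = linext (\<lambda>((a, b), (c, d)). bvec ((a, c), (b, d)))"

text \<open>The linear map \<open>B \<otimes> B \<rightarrow> B\<close> induced by a bilinear product.\<close>

definition mult_map ::
  "(('b \<Rightarrow>\<^sub>0 'k) \<Rightarrow> ('b \<Rightarrow>\<^sub>0 'k) \<Rightarrow> ('b \<Rightarrow>\<^sub>0 'k)) \<Rightarrow> ('b \<times> 'b \<Rightarrow>\<^sub>0 'k) \<Rightarrow> ('b \<Rightarrow>\<^sub>0 'k::field)" where
  "mult_map m = linext (\<lambda>(a, b). m (bvec a) (bvec b))"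


section \<open>Not necessarily associative bialgebras\<close>

text \<open>
  The underlying space is the span \<open>B\<close> of \<open>X\<close>. The axiom that \<open>(Id \<otimes> \<epsilon>) \<circ> \<Delta>\<close> is the canonical
  isomorphism \<open>B \<rightarrow> B \<otimes> K\<close> is omitted: the coproduct of trees defined below does not satisfy it,
  for any linear form \<open>\<epsilon>\<close> (lemma \<open>no_right_counit\<close>).
\<close>

locale left_counital_bialgebra =
  fixes X :: "'b set"
    and u :: "'b \<Rightarrow>\<^sub>0 'k::field"
    and m :: "('b \<Rightarrow>\<^sub>0 'k) \<Rightarrow> ('b \<Rightarrow>\<^sub>0 'k) \<Rightarrow> ('b \<Rightarrow>\<^sub>0 'k)"
    and \<Delta> :: "('b \<Rightarrow>\<^sub>0 'k) \<Rightarrow> ('b \<times> 'b \<Rightarrow>\<^sub>0 'k)"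
    and \<epsilon> :: "('b \<Rightarrow>\<^sub>0 'k) \<Rightarrow> 'k"
  assumes unit_closed: "u \<in> span_on X"
    and mult_closed: "\<And>x y. x \<in> span_on X \<Longrightarrow> y \<in> span_on X \<Longrightarrow> m x y \<in> span_on X"
    and mult_linear_left: "\<And>y. y \<in> span_on X \<Longrightarrow> linear_on X (\<lambda>x. m x y)"
    and mult_linear_right: "\<And>x. x \<in> span_on X \<Longrightarrow> linear_on X (m x)"
    and unit_left: "\<And>x. x \<in> span_on X \<Longrightarrow> m u x = x"
    and unit_right: "\<And>x. x \<in> span_on X \<Longrightarrow> m x u = x"
    and comult_closed: "\<And>x. x \<in> span_on X \<Longrightarrow> \<Delta> x \<in> span_on (X \<times> X)"
    and comult_linear: "linear_on X \<Delta>"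
    and counit_linear: "functional_on X \<epsilon>"
    and coassociative: "\<And>x. x \<in> span_on X \<Longrightarrow>
          tensor_assoc (tensor_map \<Delta> id (\<Delta> x)) = tensor_map id \<Delta> (\<Delta> x)"
    and left_counit: "\<And>x. x \<in> span_on X \<Longrightarrow> form_tensor_id \<epsilon> (\<Delta> x) = x"
    and comult_mult: "\<And>z. z \<in> span_on (X \<times> X) \<Longrightarrow>
          \<Delta> (mult_map m z) = tensor_map (mult_map m) (mult_map m) (tau23 (tensor_map \<Delta> \<Delta> z))"
    and comult_unit: "\<Delta> u = tensor u u"
    and counit_mult: "\<And>x y. x \<in> span_on X \<Longrightarrow> y \<in> span_on X \<Longrightarrow> \<epsilon> (m x y) = \<epsilon> x * \<epsilon> y"
    and counit_unit: "\<epsilon> u = 1"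

definition commutative_on where
  "commutative_on X m \<longleftrightarrow> (\<forall>x\<in>span_on X. \<forall>y\<in>span_on X. m x y = m y x)"

definition associative_on where
  "associative_on X m \<longleftrightarrow>
     (\<forall>x\<in>span_on X. \<forall>y\<in>span_on X. \<forall>z\<in>span_on X. m (m x y) z = m x (m y z))"

definition cocommutative_on where
  "cocommutative_on X \<Delta> \<longleftrightarrow> (\<forall>x\<in>span_on X. tensor_flip (\<Delta> x) = \<Delta> x)"


section \<open>Decorated rooted forests\<close>

text \<open>Forests up to isomorphism are multisets of trees. The product that the type
  \<open>'w forest \<Rightarrow>\<^sub>0 'k\<close> carries is the bilinear extension of the concatenation of forests,
  with unit \<open>1 = bvec {#}\<close>, the empty forest.\<close>

datatype 'w rtree = Node 'w "'w rtree multiset"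

type_synonym 'w forest = "'w rtree multiset"

primrec nvert :: "'w rtree \<Rightarrow> nat" where
  "nvert (Node a f) = Suc (\<Sum>t\<in>#f. nvert t)"

text \<open>The empty tree \<open>{#}\<close> is included.\<close>

definition trees :: "'w forest set" where
  "trees = {F. size F \<le> 1}"

definition Bplus :: "'w \<Rightarrow> ('w forest \<Rightarrow>\<^sub>0 'k) \<Rightarrow> ('w forest \<Rightarrow>\<^sub>0 'k::field)" where
  "Bplus a = linext (\<lambda>f. bvec {#Node a f#})"

lemma nvert_le: "t \<in># F \<Longrightarrow> nvert t \<le> (\<Sum>t\<in>#F. nvert t)"
  by (metis le_add1 multi_member_split sum_mset.insert image_mset_add_mset)

lemma sum_mset_fundef_cong [fundef_cong]:
  "M = N \<Longrightarrow> (\<And>x. x \<in># N \<Longrightarrow> f x = g x) \<Longrightarrow> image_mset f M = image_mset g N"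
  by (auto intro: image_mset_cong)

text \<open>
  For one tree on each side, the last formula for forests reduces to the shuffle of the two trees
  (lemma \<open>shuffle_forest_trees\<close>). The sums run over occurrences, so with multiplicity. If the
  characteristic divides \<open>k n\<close>, the factor is \<open>1 / 0 = 0\<close>.
\<close>

function shuffle_tree ::
    "('w \<Rightarrow> 'w \<Rightarrow> 'w) \<Rightarrow> 'k::field \<Rightarrow> 'w rtree \<Rightarrow> 'w rtree \<Rightarrow> ('w forest \<Rightarrow>\<^sub>0 'k)"
  and shuffle_forest ::
    "('w \<Rightarrow> 'w \<Rightarrow> 'w) \<Rightarrow> 'k::field \<Rightarrow> 'w forest \<Rightarrow> 'w forest \<Rightarrow> ('w forest \<Rightarrow>\<^sub>0 'k)" where
  "shuffle_tree dot lam (Node a f) (Node b g) =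
     Bplus a (shuffle_forest dot lam f {#Node b g#}) +
     Bplus b (shuffle_forest dot lam {#Node a f#} g) +
     scale lam (Bplus (dot a b) (shuffle_forest dot lam f g))"
| "shuffle_forest dot lam F G =
     (if F = {#} then bvec G
      else if G = {#} then bvec F
      else scale (1 / of_nat (size F * size G))
        (\<Sum>T\<in>#F. \<Sum>t\<in>#G. shuffle_tree dot lam T t * bvec ((F - {#T#}) + (G - {#t#}))))"
  by pat_completeness auto
termination
  by (relation "measure (\<lambda>s. case s of
        Inl (_, _, T, t) \<Rightarrow> 2 * (nvert T + nvert t)
      | Inr (_, _, F, G) \<Rightarrow> 2 * ((\<Sum>t\<in>#F. nvert t) + (\<Sum>t\<in>#G. nvert t)) + 1)")
     (auto dest!: nvert_le)

declare shuffle_forest.simps [simp del]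

definition shuffle ::
  "('w \<Rightarrow> 'w \<Rightarrow> 'w) \<Rightarrow> 'k::field \<Rightarrow> ('w forest \<Rightarrow>\<^sub>0 'k) \<Rightarrow> ('w forest \<Rightarrow>\<^sub>0 'k) \<Rightarrow> ('w forest \<Rightarrow>\<^sub>0 'k)"
  where "shuffle dot lam x y = linext (\<lambda>F. linext (\<lambda>G. shuffle_forest dot lam F G) y) x"

text \<open>In the second case of the next definition the sum has exactly one term.\<close>

primrec coproduct_tree :: "'w rtree \<Rightarrow> ('w forest \<times> 'w forest \<Rightarrow>\<^sub>0 'k::field)" where
  "coproduct_tree (Node a f) =
     (if f = {#} then tensor_map (Bplus a) id (bvec ({#}, {#}))
      else if size f = 1 then tensor_map (Bplus a) id (\<Sum>t\<in>#f. coproduct_tree t)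
      else 0) + bvec ({#}, {#Node a f#})"

text \<open>Only the values on the span of \<open>trees\<close> are meaningful.\<close>

definition coproduct :: "('w forest \<Rightarrow>\<^sub>0 'k) \<Rightarrow> ('w forest \<times> 'w forest \<Rightarrow>\<^sub>0 'k::field)" where
  "coproduct = linext (\<lambda>F. if F = {#} then bvec ({#}, {#}) else \<Sum>t\<in>#F. coproduct_tree t)"

definition counit :: "('w forest \<Rightarrow>\<^sub>0 'k) \<Rightarrow> 'k::field" where
  "counit x = Poly_Mapping.lookup x {#}"


section \<open>Basic facts\<close>

lemma scale_one: "scale 1 x = x"
  unfolding scale_def by (rule poly_mapping_eqI) (simp add: Poly_Mapping.map.rep_eq when_def)

lemma linext_single: "linext f (bvec b) = f b"
  by (simp add: linext_def scale_one)

lemma shuffle_forest_empty: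
  "shuffle_forest dot lam {#} G = bvec G" "shuffle_forest dot lam F {#} = bvec F"
  by (simp_all add: shuffle_forest.simps)

lemma shuffle_forest_trees: "shuffle_forest dot lam {#T#} {#t#} = shuffle_tree dot lam T t"
  by (simp add: shuffle_forest.simps scale_one)

lemma coproduct_branching:
  assumes "size f \<ge> 2"
  shows "coproduct (bvec {#Node a f#}) = bvec ({#}, {#Node a f#})"
proof -
  have "f \<noteq> {#}" "size f \<noteq> 1" using assms by auto
  then show ?thesis by (simp add: coproduct_def linext_single)
qed

lemma no_right_counit:
  fixes \<epsilon> :: "('w forest \<Rightarrow>\<^sub>0 'k::field) \<Rightarrow> 'k"
  assumes "size f \<ge> 2"
  shows "id_tensor_form \<epsilon> (coproduct (bvec {#Node a f#})) \<noteq> bvec {#Node a f#}"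
proof
  assume "id_tensor_form \<epsilon> (coproduct (bvec {#Node a f#})) = bvec {#Node a f#}"
  then have "scale (\<epsilon> (bvec {#Node a f#})) (bvec {#}) = bvec {#Node a f#}"
    unfolding coproduct_branching[OF assms] by (simp add: id_tensor_form_def linext_single)
  then have "Poly_Mapping.lookup (scale (\<epsilon> (bvec {#Node a f#})) (bvec {#})) {#Node a f#} = 1"
    by simp
  then show False by (simp add: scale_def Poly_Mapping.map.rep_eq lookup_single when_def del: single_one)
qed

end

theory Submission
  imports Defs
begin

text \<open>
  \<^bold>\<open>The bialgebra axioms.\<close> The coproduct of a tree cuts the unary chain that starts at the root. It
  becomes tractable once it is extended to all forests by the value \<open>0\<close> on forests with at least two
  trees (\<open>coproduct_ext\<close>, written \<open>E\<close> here): the three cases of the recursion then merge into the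
  single cocycle identity
  \<open>E (B\<^sub>+ x) = (B\<^sub>+ \<otimes> Id) (E x) + \<emptyset> \<otimes> B\<^sub>+ x\<close> (\<open>coproduct_ext_Bplus\<close>). Coassociativity follows from it by
  induction along the chain. For the compatibility with the product, the
  point is that \<open>E\<close> is multiplicative on \<^emph>\<open>all\<close> forests (\<open>coproduct_ext_shuffle_basis\<close>). The shuffle of
  two non-empty forests of sizes \<open>k\<close> and \<open>n\<close> consists of forests of size \<open>k + n - 1\<close>, so if \<open>k\<close> or \<open>n\<close>
  exceeds \<open>1\<close>, both sides vanish, whatever the coefficients \<open>1 / (k n)\<close> are; and for two
  trees the cocycle identity and the recursion of the shuffle produce the same four terms on both
  sides, by induction.

  \<^bold>\<open>Commutativity\<close> is visible in the recursion, by induction.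

  \<^bold>\<open>Failure of associativity.\<close> Shuffling a forest \<open>f\<close> with one tree changes only one tree of \<open>f\<close>. If
  exactly two trees of \<open>f\<close> differ from \<open>u\<close>, then \<open>u\<^sup>k\<close> cannot be reached by shuffling \<open>f\<close> with a single
  tree, but it can be reached by shuffling with two trees one after the other. Grafting \<open>f\<close> on a root
  turns this into a failure of \<open>(x y) z = x (y z)\<close>. With suitable trees the relevant coefficient is
  exactly \<open>1 / k\<^sup>2\<close>, for every \<open>\<lambda>\<close>; as \<open>3\<close> and \<open>4\<close> do not both vanish in the field, \<open>k\<close> can be chosen to
  be non-zero in any characteristic (\<open>not_associative\<close>).

  \<^bold>\<open>Failure of cocommutativity.\<close> A tree \<open>T\<close> whose root has two children has coproduct \<open>\<emptyset> \<otimes> T\<close>.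
\<close>

text \<open>The unit is kept in the form \<open>bvec {#}\<close>, so that the rules about basis vectors apply to it.\<close>

declare single_one [simp del]

section \<open>Linear maps between free vector spaces\<close>

lemma lookup_scale [simp]: "Poly_Mapping.lookup (scale c x) b = c * Poly_Mapping.lookup x b"
  by (simp add: scale_def Poly_Mapping.map.rep_eq when_def)

lemma scale_add: "scale c (x + y) = scale c x + scale c y"
  and scale_scale: "scale c (scale d x) = scale (c * d) x"
  and scale_zero_left [simp]: "scale 0 x = 0"
  and scale_zero_right [simp]: "scale c 0 = 0"
  by (rule poly_mapping_eqI; simp add: lookup_add algebra_simps)+

abbreviation lin :: "(('b \<Rightarrow>\<^sub>0 'k) \<Rightarrow> ('c \<Rightarrow>\<^sub>0 'k::field)) \<Rightarrow> bool" where
  "lin \<equiv> linear_on UNIV"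

lemma lin_iff:
  "lin f \<longleftrightarrow> (\<forall>x y. f (x + y) = f x + f y) \<and> (\<forall>c x. f (scale c x) = scale c (f x))"
  by (simp add: linear_on_def span_on_def)

lemma lin_add: "lin f \<Longrightarrow> f (x + y) = f x + f y"
  and lin_scale: "lin f \<Longrightarrow> f (scale c x) = scale c (f x)"
  by (auto simp: lin_iff)

lemma lin_zero: "lin f \<Longrightarrow> f 0 = 0"
  by (metis lin_scale scale_zero_left)

lemma lookup_sum_mset:
  "Poly_Mapping.lookup (\<Sum>x\<in>#M. g x) v = (\<Sum>x\<in>#M. Poly_Mapping.lookup (g x) v)"
  by (induction M) (auto simp: lookup_add)

text \<open>A common superset of the supports makes it possible to compare \<open>linext\<close> at several vectors.\<close>

lemma lookup_linext_superset:
  assumes "finite A" "Poly_Mapping.keys x \<subseteq> A"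
  shows "Poly_Mapping.lookup (linext f x) v =
    (\<Sum>b\<in>A. Poly_Mapping.lookup x b * Poly_Mapping.lookup (f b) v)"
proof -
  have "(\<Sum>b\<in>A. Poly_Mapping.lookup x b * Poly_Mapping.lookup (f b) v) =
    (\<Sum>b\<in>Poly_Mapping.keys x. Poly_Mapping.lookup x b * Poly_Mapping.lookup (f b) v)"
    by (rule sum.mono_neutral_right) (use assms in \<open>auto simp: in_keys_iff\<close>)
  then show ?thesis
    by (simp add: linext_def lookup_sum)
qed

lemmas lookup_linext = lookup_linext_superset [OF finite_keys order_refl]

lemma lin_linext:
  fixes f :: "'b \<Rightarrow> ('c \<Rightarrow>\<^sub>0 'k::field)"
  shows "lin (linext f)"
proof -
  have "linext f (x + y) = linext f x + linext f y" for x y :: "'b \<Rightarrow>\<^sub>0 'k"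
  proof (rule poly_mapping_eqI)
    fix v
    let ?A = "Poly_Mapping.keys x \<union> Poly_Mapping.keys y"
    have "Poly_Mapping.keys (x + y) \<subseteq> ?A" by (rule Poly_Mapping.keys_add)
    then show "Poly_Mapping.lookup (linext f (x + y)) v =
        Poly_Mapping.lookup (linext f x + linext f y) v"
      by (simp add: lookup_linext_superset [where A = ?A] lookup_add sum.distrib distrib_right)
  qed
  moreover have "linext f (scale c x) = scale c (linext f x)" for c and x :: "'b \<Rightarrow>\<^sub>0 'k"
  proof (rule poly_mapping_eqI)
    fix v
    let ?A = "Poly_Mapping.keys x"
    have "Poly_Mapping.keys (scale c x) \<subseteq> ?A" by (auto simp: in_keys_iff)
    then show "Poly_Mapping.lookup (linext f (scale c x)) v =
        Poly_Mapping.lookup (scale c (linext f x)) v"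
      by (simp add: lookup_linext_superset [where A = ?A] sum_distrib_left mult.assoc)
  qed
  ultimately show ?thesis by (simp add: lin_iff)
qed

lemma linext_bvec_id: "linext bvec x = x"
  by (rule poly_mapping_eqI)
    (simp add: lookup_linext lookup_single when_def in_keys_iff if_distrib [where f = "(*) _"] cong: if_cong)

lemma lin_sum: "lin f \<Longrightarrow> f (\<Sum>b\<in>A. g b) = (\<Sum>b\<in>A. f (g b))"
  by (induction A rule: infinite_finite_induct) (simp_all add: lin_zero [of f] lin_add [of f])

lemma lin_eq_linext: "lin f \<Longrightarrow> f x = linext (\<lambda>b. f (bvec b)) x"
  by (subst linext_bvec_id [of x, symmetric]) (simp add: linext_def lin_sum [of f] lin_scale [of f])

lemma linext_cong: "x \<in> span_on X \<Longrightarrow> (\<And>b. b \<in> X \<Longrightarrow> f b = g b) \<Longrightarrow> linext f x = linext g x"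
  unfolding linext_def span_on_def by (rule sum.cong) auto

lemma span_UNIV [simp]: "x \<in> span_on UNIV"
  by (simp add: span_on_def)

text \<open>Almost every identity below is an equality of linear maps and is reduced to basis vectors by the
  next two rules.\<close>

lemma lin_eqI_on:
  assumes "lin f" "lin g" "x \<in> span_on X" "\<And>b. b \<in> X \<Longrightarrow> f (bvec b) = g (bvec b)"
  shows "f x = g x"
  using assms lin_eq_linext [of f x] lin_eq_linext [of g x]
    linext_cong [of x X "\<lambda>b. f (bvec b)" "\<lambda>b. g (bvec b)"] by simp

lemma lin_eqI: "lin f \<Longrightarrow> lin g \<Longrightarrow> (\<And>b. f (bvec b) = g (bvec b)) \<Longrightarrow> f x = g x"
  by (rule lin_eqI_on [of f g x UNIV]) auto

lemma lin_compose: "lin f \<Longrightarrow> lin g \<Longrightarrow> lin (\<lambda>x. f (g x))"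
  and lin_id: "lin (\<lambda>x. x)"
  and lin_plus: "lin g \<Longrightarrow> lin h \<Longrightarrow> lin (\<lambda>x. g x + h x)"
  and lin_scaled: "lin g \<Longrightarrow> lin (\<lambda>x. scale c (g x))"
  by (simp_all add: lin_iff scale_add scale_scale mult.commute add.commute add.left_commute)

lemma lin_const_zero: "lin (\<lambda>x. 0)"
  by (auto simp: lin_iff)

lemma lin_sum_of_maps: "(\<And>b. lin (h b)) \<Longrightarrow> lin (\<lambda>y. \<Sum>b\<in>A. h b y)"
  by (induction A rule: infinite_finite_induct) (auto intro: lin_plus lin_const_zero)

text \<open>A map defined by two nested extensions, such as \<open>tensor\<close> or \<open>shuffle\<close>, is linear in its inner
  argument.\<close>

lemma lin_linext_parameter: "(\<And>b. lin (h b)) \<Longrightarrow> lin (\<lambda>y. linext (\<lambda>b. h b y) x)"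
  unfolding linext_def by (intro lin_sum_of_maps lin_scaled)

lemma lin_linext_comp: "lin g \<Longrightarrow> lin (\<lambda>x. linext f (g x))"
  using lin_compose lin_linext by blast

lemma lin_linear_on: "lin f \<Longrightarrow> linear_on X f"
  by (simp add: linear_on_def)

lemma span_bvec: "b \<in> X \<Longrightarrow> bvec b \<in> span_on X"
  by (auto simp: span_on_def split: if_splits)

lemma span_add: "x \<in> span_on X \<Longrightarrow> y \<in> span_on X \<Longrightarrow> x + y \<in> span_on X"
  using Poly_Mapping.keys_add [of x y] by (auto simp: span_on_def)

lemma span_scale: "x \<in> span_on X \<Longrightarrow> scale c x \<in> span_on X"
  by (auto simp: span_on_def in_keys_iff)

lemma span_zero: "0 \<in> span_on X"
  by (simp add: span_on_def)

lemma span_sum: "(\<And>b. b \<in> A \<Longrightarrow> g b \<in> span_on X) \<Longrightarrow> (\<Sum>b\<in>A. g b) \<in> span_on X"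
  by (induction A rule: infinite_finite_induct) (auto intro: span_add span_zero)

lemma span_sum_mset: "(\<And>b. b \<in># M \<Longrightarrow> g b \<in> span_on X) \<Longrightarrow> (\<Sum>b\<in>#M. g b) \<in> span_on X"
  by (induction M) (auto intro: span_add span_zero)

lemma span_linext:
  "x \<in> span_on Y \<Longrightarrow> (\<And>b. b \<in> Y \<Longrightarrow> f b \<in> span_on X) \<Longrightarrow> linext f x \<in> span_on X"
  unfolding linext_def by (intro span_sum span_scale) (auto simp: span_on_def)

lemma span_mono: "x \<in> span_on X \<Longrightarrow> X \<subseteq> Y \<Longrightarrow> x \<in> span_on Y"
  by (auto simp: span_on_def)

section \<open>Tensor products of linear maps\<close>

lemma tensor_bvec: "tensor (bvec b) (bvec c) = bvec (b, c)"
  by (simp add: tensor_def linext_single)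

lemma lin_tensor_left: "lin g \<Longrightarrow> lin (\<lambda>x. tensor (g x) y)"
  unfolding tensor_def by (rule lin_linext_comp)

lemma lin_tensor_right: "lin g \<Longrightarrow> lin (\<lambda>x. tensor y (g x))"
  unfolding tensor_def by (intro lin_linext_parameter lin_linext_comp)

lemma tensor_map_bvec: "tensor_map f g (bvec (b, c)) = tensor (f (bvec b)) (g (bvec c))"
  by (simp add: tensor_map_def linext_single)

lemma lin_tensor_map: "lin h \<Longrightarrow> lin (\<lambda>x. tensor_map f g (h x))"
  unfolding tensor_map_def by (rule lin_linext_comp)

lemma tensor_map_tensor:
  assumes "lin f" "lin g"
  shows "tensor_map f g (tensor x y) = tensor (f x) (g y)"
proof (rule lin_eqI [of _ _ x])
  fix b
  show "tensor_map f g (tensor (bvec b) y) = tensor (f (bvec b)) (g y)"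
    by (rule lin_eqI [of _ _ y])
      (auto intro!: lin_tensor_map lin_tensor_right lin_id assms simp: tensor_bvec tensor_map_bvec)
qed (auto intro!: lin_tensor_map lin_tensor_left lin_id assms)

section \<open>The algebra of forests\<close>

lemma Bplus_bvec: "Bplus a (bvec f) = bvec {#Node a f#}"
  by (simp add: Bplus_def linext_single)

lemma lin_Bplus: "lin g \<Longrightarrow> lin (\<lambda>x. Bplus a (g x))"
  unfolding Bplus_def by (rule lin_linext_comp)

lemma span_Bplus: "Bplus a x \<in> span_on {H. size H = 1}"
  unfolding Bplus_def by (rule span_linext [OF span_UNIV]) (auto intro: span_bvec)

lemma span_times_bvec:
  assumes "x \<in> span_on X" "\<And>H. H \<in> X \<Longrightarrow> H + R \<in> Y"
  shows "x * bvec R \<in> span_on Y"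
  using assms keys_mult [of x "bvec R"] by (fastforce simp: span_on_def split: if_splits)

text \<open>Multiplication by a basis vector translates the supports, injectively since multiset addition
  is cancellative.\<close>

lemma lookup_times_bvec:
  fixes x :: "'a multiset \<Rightarrow>\<^sub>0 'k::field"
  shows "Poly_Mapping.lookup (x * bvec R) U = (if R \<subseteq># U then Poly_Mapping.lookup x (U - R) else 0)"
proof -
  have "lin (\<lambda>x. x * bvec R :: 'a multiset \<Rightarrow>\<^sub>0 'k)"
    by (simp add: lin_iff scale_def mult_map_scale_conv_mult algebra_simps)
  then have "x * bvec R = linext (\<lambda>F. bvec (F + R)) x"
    by (subst lin_eq_linext [where f = "\<lambda>x. x * bvec R"]) (simp_all add: mult_single)
  moreover have "F + R = U \<longleftrightarrow> R \<subseteq># U \<and> F = U - R" for F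
    by (auto simp: subset_mset.diff_add)
  ultimately show ?thesis
    by (simp add: lookup_linext lookup_single when_def in_keys_iff
        if_distrib [where f = "(*) _"] cong: if_cong)
qed

section \<open>The coproduct\<close>

text \<open>Forests with at least two trees are sent to \<open>0\<close>: this value makes the cocycle identity
  \<open>coproduct_ext_Bplus\<close> hold without case distinction, and it makes the map multiplicative.\<close>

definition coproduct_ext :: "('w forest \<Rightarrow>\<^sub>0 'k) \<Rightarrow> ('w forest \<times> 'w forest \<Rightarrow>\<^sub>0 'k::field)" where
  "coproduct_ext = linext (\<lambda>F. if size F \<le> 1 then coproduct (bvec F) else 0)"

text \<open>The right factor is arbitrary, so that the same operator also acts on triple tensors.\<close>

definition graft_left ::
  "'w \<Rightarrow> ('w forest \<times> 'c \<Rightarrow>\<^sub>0 'k) \<Rightarrow> ('w forest \<times> 'c \<Rightarrow>\<^sub>0 'k::field)" where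
  "graft_left a = tensor_map (Bplus a) id"

lemma lin_graft_left: "lin g \<Longrightarrow> lin (\<lambda>x. graft_left a (g x))"
  unfolding graft_left_def by (rule lin_tensor_map)

lemma id_lin: "lin id"
  by (simp add: lin_iff)

lemma lin_coproduct_ext: "lin g \<Longrightarrow> lin (\<lambda>x. coproduct_ext (g x))"
  unfolding coproduct_ext_def by (rule lin_linext_comp)

lemma lin_tensor_assoc: "lin g \<Longrightarrow> lin (\<lambda>x. tensor_assoc (g x))"
  unfolding tensor_assoc_def by (rule lin_linext_comp)

lemma tensor_assoc_bvec: "tensor_assoc (bvec ((a, b), c)) = bvec (a, (b, c))"
  by (simp add: tensor_assoc_def linext_single)

lemmas lin_intros = lin_id lin_plus lin_scaled lin_const_zero lin_tensor_left lin_tensor_right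
  lin_tensor_map lin_graft_left lin_Bplus lin_coproduct_ext lin_tensor_assoc

lemma graft_left_bvec: "graft_left a (bvec (p, q)) = bvec ({#Node a p#}, q)"
  by (simp add: graft_left_def tensor_map_bvec Bplus_bvec tensor_bvec)

lemma graft_left_tensor: "graft_left a (tensor x y) = tensor (Bplus a x) y"
  by (simp add: graft_left_def tensor_map_tensor id_lin lin_Bplus lin_id)

lemma coproduct_ext_empty: "coproduct_ext (bvec {#}) = bvec ({#}, {#})"
  by (simp add: coproduct_ext_def coproduct_def linext_single)

lemma coproduct_ext_nonconnected: "size F \<ge> 2 \<Longrightarrow> coproduct_ext (bvec F) = 0"
  by (simp add: coproduct_ext_def linext_single)

lemma coproduct_ext_node:
  "coproduct_ext (bvec {#Node a f#}) =
     graft_left a (coproduct_ext (bvec f)) + bvec ({#}, {#Node a f#})"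
proof -
  consider "f = {#}" | t where "f = {#t#}" | "size f \<ge> 2"
    by (metis One_nat_def Suc_1 less_2_cases not_le size_1_singleton_mset size_eq_0_iff_empty)
  then show ?thesis
  proof cases
    case 1
    then show ?thesis by (simp add: graft_left_def coproduct_ext_def coproduct_def linext_single)
  next
    case 2
    then show ?thesis by (simp add: graft_left_def coproduct_ext_def coproduct_def linext_single)
  next
    case 3
    moreover from this have "f \<noteq> {#}" "size f \<noteq> 1" by auto
    ultimately show ?thesis
      by (simp add: coproduct_ext_nonconnected lin_zero [of "graft_left _"] lin_graft_left lin_id)
        (simp add: coproduct_ext_def coproduct_def linext_single)
  qed
qed

text \<open>Induction along the chain of vertices with one child: the recursion of the coproduct stops at the
  first branching, so a non-connected forest is a base case.\<close>

lemma forest_chain_induct [case_names empty nonconnected node]: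
  assumes "P {#}" "\<And>F. size F \<ge> 2 \<Longrightarrow> P F" "\<And>a f. P f \<Longrightarrow> P {#Node a f#}"
  shows "P F"
proof -
  have step: "P F" if "\<And>t. t \<in># F \<Longrightarrow> P {#t#}" for F
  proof -
    consider "F = {#}" | t where "F = {#t#}" | "size F \<ge> 2"
      by (metis One_nat_def Suc_1 less_2_cases not_le size_1_singleton_mset size_eq_0_iff_empty)
    then show ?thesis using assms that by cases auto
  qed
  have "P {#t#}" for t
    by (induction t) (auto intro: step assms(3))
  then show ?thesis by (rule step)
qed

lemma empty_tree [simp]: "{#} \<in> trees" and single_tree [simp]: "{#t#} \<in> trees"
  by (simp_all add: trees_def)

text \<open>The cocycle identity. It holds for every combination \<open>x\<close> of forests because non-connected
  forests contribute \<open>0\<close> to the first summand.\<close>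

lemma coproduct_ext_Bplus:
  "coproduct_ext (Bplus a x) = graft_left a (coproduct_ext x) + tensor (bvec {#}) (Bplus a x)"
  by (rule lin_eqI [of _ _ x])
    (auto intro!: lin_intros simp: Bplus_bvec coproduct_ext_node tensor_bvec)

lemma span_graft_left: "P \<in> span_on (trees \<times> trees) \<Longrightarrow> graft_left a P \<in> span_on (trees \<times> trees)"
  unfolding graft_left_def tensor_map_def
  by (rule span_linext, assumption) (auto simp: Bplus_bvec tensor_bvec trees_def intro!: span_bvec)

lemma span_coproduct_ext: "coproduct_ext x \<in> span_on (trees \<times> trees)"
proof -
  have "coproduct_ext (bvec F) \<in> span_on (trees \<times> trees)" for F :: "'a forest"
    by (induction F rule: forest_chain_induct)
      (auto simp: coproduct_ext_empty coproduct_ext_nonconnected coproduct_ext_node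
        intro!: span_bvec span_add span_zero span_graft_left)
  then show ?thesis
    by (subst lin_eq_linext [where f = coproduct_ext])
      (auto intro: lin_coproduct_ext [OF lin_id] span_linext [OF span_UNIV])
qed

lemma coproduct_eq_ext: "x \<in> span_on trees \<Longrightarrow> coproduct x = coproduct_ext x"
  unfolding coproduct_def coproduct_ext_def
  by (rule linext_cong, assumption) (auto simp: trees_def linext_single)

lemma tensor_assoc_graft_left:
  "tensor_assoc (tensor (graft_left a X) y) = graft_left a (tensor_assoc (tensor X y))"
proof (rule lin_eqI [of _ _ y])
  fix c
  show "tensor_assoc (tensor (graft_left a X) (bvec c)) =
      graft_left a (tensor_assoc (tensor X (bvec c)))"
    by (rule lin_eqI [of _ _ X])
      (auto intro!: lin_intros simp: graft_left_bvec tensor_bvec tensor_assoc_bvec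
        graft_left_bvec)
qed (auto intro!: lin_intros)

text \<open>The step of the induction for coassociativity on the side \<open>(E \<otimes> Id) E\<close>; the new term comes from
  the second summand of the cocycle identity. The lemma after it is the step for \<open>(Id \<otimes> E) E\<close>.\<close>

lemma coproduct_ext_graft_left:
  fixes P :: "'a forest \<times> 'a forest \<Rightarrow>\<^sub>0 'k::field"
  shows "tensor_assoc (tensor_map coproduct_ext id (graft_left a P)) =
     graft_left a (tensor_assoc (tensor_map coproduct_ext id P)) +
     tensor (bvec {#}) (graft_left a P)"
proof (rule lin_eqI [of _ _ P])
  fix b :: "'a forest \<times> 'a forest"
  obtain p q where b: "b = (p, q)" by (cases b)
  let ?e = "coproduct_ext (bvec p) :: _ \<Rightarrow>\<^sub>0 'k"
  have "tensor_assoc (tensor_map coproduct_ext id (graft_left a (bvec b))) =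
      tensor_assoc (tensor (graft_left a ?e + bvec ({#}, {#Node a p#})) (bvec q))"
    by (simp add: b graft_left_bvec tensor_map_bvec coproduct_ext_node)
  also have "\<dots> = tensor_assoc (tensor (graft_left a ?e) (bvec q)) +
      tensor_assoc (tensor (bvec ({#}, {#Node a p#})) (bvec q))"
    by (rule lin_add [where f = "\<lambda>x. tensor_assoc (tensor x (bvec q))"]) (intro lin_intros)
  finally show "tensor_assoc (tensor_map coproduct_ext id (graft_left a (bvec b))) =
     graft_left a (tensor_assoc (tensor_map coproduct_ext id (bvec b))) +
     tensor (bvec {#}) (graft_left a (bvec b :: _ \<Rightarrow>\<^sub>0 'k))"
    by (simp add: b tensor_assoc_graft_left tensor_bvec tensor_assoc_bvec graft_left_bvec
        tensor_map_bvec [of coproduct_ext id])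
qed (auto intro!: lin_intros)

lemma graft_left_coproduct_ext:
  fixes P :: "'a forest \<times> 'a forest \<Rightarrow>\<^sub>0 'k::field"
  shows "tensor_map id coproduct_ext (graft_left a P) =
     graft_left a (tensor_map id coproduct_ext P)"
proof (rule lin_eqI [of _ _ P])
  fix b :: "'a forest \<times> 'a forest"
  show "tensor_map id coproduct_ext (graft_left a (bvec b)) =
     graft_left a (tensor_map id coproduct_ext (bvec b :: _ \<Rightarrow>\<^sub>0 'k))"
    by (cases b) (simp add: graft_left_bvec tensor_map_bvec graft_left_tensor Bplus_bvec)
qed (auto intro!: lin_intros)

lemma coassociative_coproduct_ext:
  fixes x :: "'a forest \<Rightarrow>\<^sub>0 'k::field"
  shows "tensor_assoc (tensor_map coproduct_ext id (coproduct_ext x)) =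
     tensor_map id coproduct_ext (coproduct_ext x)"
proof -
  have basis: "tensor_assoc (tensor_map coproduct_ext id (coproduct_ext (bvec F))) =
      tensor_map id coproduct_ext (coproduct_ext (bvec F :: _ \<Rightarrow>\<^sub>0 'k))" for F :: "'a forest"
  proof (induction F rule: forest_chain_induct)
    case empty
    show ?case
      by (simp add: coproduct_ext_empty tensor_map_bvec tensor_bvec tensor_assoc_bvec)
  next
    case (nonconnected F)
    then show ?case
      by (simp add: coproduct_ext_nonconnected lin_zero [of "tensor_map _ _"]
          lin_zero [of tensor_assoc] lin_intros)
  next
    case (node a f)
    let ?P = "coproduct_ext (bvec f) :: _ \<Rightarrow>\<^sub>0 'k" and ?N = "{#Node a f#}"
    have "tensor_assoc (tensor_map coproduct_ext id (coproduct_ext (bvec ?N :: _ \<Rightarrow>\<^sub>0 'k))) =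
        tensor_assoc (tensor_map coproduct_ext id (graft_left a ?P)) + bvec ({#}, {#}, ?N)"
      by (simp add: coproduct_ext_node lin_add [of "tensor_map _ _"] lin_add [of "graft_left _"] lin_add [of tensor_assoc]
          lin_intros tensor_map_bvec coproduct_ext_empty tensor_bvec tensor_assoc_bvec)
    also have "\<dots> = graft_left a (tensor_map id coproduct_ext ?P) +
        tensor (bvec {#}) (graft_left a ?P) + bvec ({#}, {#}, ?N)"
      by (simp only: coproduct_ext_graft_left node)
    also have "\<dots> = tensor_map id coproduct_ext (graft_left a ?P) +
        tensor (bvec {#}) (coproduct_ext (bvec ?N))"
      by (simp add: graft_left_coproduct_ext coproduct_ext_node lin_add [of "tensor _"]
          lin_intros tensor_bvec)
    also have "\<dots> = tensor_map id coproduct_ext (graft_left a ?P + bvec ({#}, ?N))"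
      by (simp add: lin_add [of "tensor_map _ _"] lin_intros tensor_map_bvec)
    also have "graft_left a ?P + bvec ({#}, ?N) = coproduct_ext (bvec ?N)"
      by (rule coproduct_ext_node [symmetric])
    finally show ?case .
  qed
  show ?thesis
    by (rule lin_eqI [where f = "\<lambda>x. tensor_assoc (tensor_map coproduct_ext id (coproduct_ext x))"
          and g = "\<lambda>x. tensor_map id coproduct_ext (coproduct_ext x)"])
      (intro lin_intros basis)+
qed

lemma lin_form_tensor_id: "lin g \<Longrightarrow> lin (\<lambda>x. form_tensor_id f (g x))"
  unfolding form_tensor_id_def by (rule lin_linext_comp)

lemma counit_bvec: "counit (bvec F) = (if F = {#} then 1 else 0)"
  by (simp add: counit_def lookup_single when_def)

text \<open>Only the summand \<open>\<emptyset> \<otimes> F\<close> survives, since all left factors in the image of \<open>graft_left\<close> are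
  non-empty.\<close>

lemma left_counit_coproduct_ext:
  fixes x :: "'a forest \<Rightarrow>\<^sub>0 'k::field"
  assumes "x \<in> span_on trees"
  shows "form_tensor_id counit (coproduct_ext x) = x"
proof (rule lin_eqI_on [OF _ _ assms])
  fix F :: "'a forest"
  assume "F \<in> trees"
  have zero: "form_tensor_id counit (graft_left a P) = 0" for a and P :: "'a forest \<times> 'a forest \<Rightarrow>\<^sub>0 'k"
    by (rule lin_eqI [of _ _ P])
      (auto intro!: lin_intros lin_linext_comp simp: graft_left_bvec form_tensor_id_def linext_single counit_bvec)
  show "form_tensor_id counit (coproduct_ext (bvec F)) = (bvec F :: _ \<Rightarrow>\<^sub>0 'k)"
  proof (cases "F = {#}")
    case True
    then show ?thesis
      by (simp add: coproduct_ext_empty form_tensor_id_def linext_single counit_bvec scale_one)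
  next
    case False
    then have "size F = 1"
      using \<open>F \<in> trees\<close> by (simp add: trees_def le_Suc_eq)
    then obtain a f where "F = {#Node a f#}"
      by (metis size_1_singleton_mset rtree.exhaust)
    then show ?thesis
      by (simp add: coproduct_ext_node lin_add [of "form_tensor_id _"] lin_form_tensor_id lin_id zero)
        (simp add: form_tensor_id_def linext_single counit_bvec scale_one)
  qed
qed (auto intro!: lin_intros lin_form_tensor_id)

section \<open>The shuffle product\<close>

context
  fixes dot :: "'w \<Rightarrow> 'w \<Rightarrow> 'w" and lam :: "'k::field"
begin

abbreviation (input) "tsh \<equiv> shuffle_tree dot lam"
abbreviation (input) "fsh \<equiv> shuffle_forest dot lam"
abbreviation (input) "lsh \<equiv> shuffle dot lam"

lemma shuffle_bvec: "lsh (bvec F) (bvec G) = fsh F G"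
  by (simp add: shuffle_def linext_single)

lemma lin_shuffle_left: "lin g \<Longrightarrow> lin (\<lambda>x. lsh (g x) y)"
  unfolding shuffle_def by (rule lin_linext_comp)

lemma lin_shuffle_right: "lin g \<Longrightarrow> lin (\<lambda>x. lsh y (g x))"
  unfolding shuffle_def by (intro lin_linext_parameter lin_linext_comp)

lemmas lin_shuffle = lin_id lin_shuffle_left lin_shuffle_right

lemma span_shuffle_tree: "tsh T t \<in> span_on {H. size H = 1}"
  by (cases T; cases t) (auto simp del: One_nat_def intro!: span_add span_scale span_Bplus)

text \<open>One tree of \<open>F\<close> and one of \<open>G\<close> merge into a single tree.\<close>

lemma span_shuffle_forest:
  assumes "F \<noteq> {#}" "G \<noteq> {#}"
  shows "fsh F G \<in> span_on {H. size H + 1 = size F + size G}"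
proof -
  have "tsh T t * bvec ((F - {#T#}) + (G - {#t#})) \<in> span_on {H. size H + 1 = size F + size G}"
    if "T \<in># F" "t \<in># G" for T t
    by (rule span_times_bvec [OF span_shuffle_tree])
      (use that in \<open>auto simp: size_Diff_singleton dest!: multi_member_split\<close>)
  then show ?thesis
    using assms by (auto simp: shuffle_forest.simps intro!: span_scale span_sum_mset)
qed

text \<open>The induction rule of the recursive definition, with the two parameters of the shuffle held
  fixed.\<close>

lemma shuffle_induct:
  fixes P :: "'w rtree \<Rightarrow> 'w rtree \<Rightarrow> bool" and Q :: "'w forest \<Rightarrow> 'w forest \<Rightarrow> bool"
  assumes "\<And>a f b g. Q f {#Node b g#} \<Longrightarrow> Q {#Node a f#} g \<Longrightarrow> Q f g \<Longrightarrow> P (Node a f) (Node b g)"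
    and "\<And>F G. (\<And>T t. F \<noteq> {#} \<Longrightarrow> G \<noteq> {#} \<Longrightarrow> T \<in># F \<Longrightarrow> t \<in># G \<Longrightarrow> P T t) \<Longrightarrow> Q F G"
  shows "P T t" "Q F G"
proof -
  note ind = shuffle_tree_shuffle_forest.induct [where P = "\<lambda>_ (_ :: 'k). P" and Q = "\<lambda>_ _. Q"]
  show "P T t" by (rule ind(1)) (fact assms)+
  show "Q F G" by (rule ind(2)) (fact assms)+
qed

lemma shuffle_commute_basis:
  assumes "lam \<noteq> 0 \<longrightarrow> abel_semigroup dot"
  shows "tsh T t = tsh t T" "fsh F G = fsh G F"
proof (induction T t and F G rule: shuffle_induct)
  case (1 a f b g)
  have "scale lam (Bplus (dot a b) x) = scale lam (Bplus (dot b a) x)" for x :: "'w forest \<Rightarrow>\<^sub>0 'k"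
    using assms by (cases "lam = 0") (auto simp: abel_semigroup.commute)
  with 1 show ?case by (simp add: add_ac)
next
  case (2 F G)
  show ?case
  proof (cases "F = {#} \<or> G = {#}")
    case True
    then show ?thesis by (auto simp: shuffle_forest_empty)
  next
    case False
    have "(\<Sum>T\<in>#F. \<Sum>t\<in>#G. tsh T t * bvec ((F - {#T#}) + (G - {#t#}))) =
        (\<Sum>t\<in>#G. \<Sum>T\<in>#F. tsh T t * bvec ((F - {#T#}) + (G - {#t#})))"
      by (rule sum_mset.swap)
    also have "\<dots> = (\<Sum>t\<in>#G. \<Sum>T\<in>#F. tsh t T * bvec ((G - {#t#}) + (F - {#T#})))"
      using 2 False by (intro arg_cong [where f = sum_mset] image_mset_cong) (simp add: add.commute)
    finally show ?thesis
      using False by (simp add: shuffle_forest.simps mult.commute)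
  qed
qed

section \<open>Multiplicativity of the coproduct\<close>

text \<open>The product \<open>(m \<otimes> m) \<circ> \<tau>\<^sub>2\<^sub>3\<close> on the tensor square (lemma \<open>tau23_tensor_shuffle\<close>), as a bilinear
  map.\<close>

definition tensor_shuffle ::
  "('w forest \<times> 'w forest \<Rightarrow>\<^sub>0 'k) \<Rightarrow> ('w forest \<times> 'w forest \<Rightarrow>\<^sub>0 'k) \<Rightarrow>
   ('w forest \<times> 'w forest \<Rightarrow>\<^sub>0 'k)" where
  "tensor_shuffle P Q =
     linext (\<lambda>p. linext (\<lambda>q. tensor (fsh (fst p) (fst q)) (fsh (snd p) (snd q))) Q) P"

lemma tensor_shuffle_bvec:
  "tensor_shuffle (bvec (p, p')) (bvec (q, q')) = tensor (fsh p q) (fsh p' q')"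
  by (simp add: tensor_shuffle_def linext_single)

lemma lin_tensor_shuffle_left: "lin g \<Longrightarrow> lin (\<lambda>P. tensor_shuffle (g P) Q)"
  unfolding tensor_shuffle_def by (rule lin_linext_comp)

lemma lin_tensor_shuffle_right: "lin g \<Longrightarrow> lin (\<lambda>Q. tensor_shuffle P (g Q))"
  unfolding tensor_shuffle_def by (intro lin_linext_parameter lin_linext_comp)

lemmas lin_tensor_shuffle = lin_tensor_shuffle_left lin_tensor_shuffle_right

lemma tensor_shuffle_unit:
  "tensor_shuffle (bvec ({#}, {#})) Q = Q" "tensor_shuffle P (bvec ({#}, {#})) = P"
  by (rule lin_eqI [of _ _ Q], auto intro!: lin_intros lin_tensor_shuffle
        simp: tensor_shuffle_bvec shuffle_forest_empty tensor_bvec)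
    (rule lin_eqI [of _ _ P], auto intro!: lin_intros lin_tensor_shuffle
        simp: tensor_shuffle_bvec shuffle_forest_empty tensor_bvec)

lemma tensor_shuffle_graft_left_unit:
  "tensor_shuffle (graft_left a P) (bvec ({#}, G)) = graft_left a (tensor_shuffle P (bvec ({#}, G)))"
  by (rule lin_eqI [of _ _ P])
    (auto intro!: lin_intros lin_tensor_shuffle
      simp: tensor_shuffle_bvec shuffle_forest_empty graft_left_bvec graft_left_tensor Bplus_bvec)

lemma tensor_shuffle_unit_graft_left:
  "tensor_shuffle (bvec ({#}, F)) (graft_left b Q) = graft_left b (tensor_shuffle (bvec ({#}, F)) Q)"
  by (rule lin_eqI [of _ _ Q])
    (auto intro!: lin_intros lin_tensor_shuffle
      simp: tensor_shuffle_bvec shuffle_forest_empty graft_left_bvec graft_left_tensor Bplus_bvec)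

text \<open>The recursion of the shuffle of trees, transported to the left tensor factor.\<close>

lemma tensor_shuffle_graft_left:
  "tensor_shuffle (graft_left a P) (graft_left b Q) =
     graft_left a (tensor_shuffle P (graft_left b Q)) +
     graft_left b (tensor_shuffle (graft_left a P) Q) +
     scale lam (graft_left (dot a b) (tensor_shuffle P Q))"
proof -
  have add: "tensor (x + y) w = tensor x w + tensor y w"
    and sc: "tensor (scale c x) w = scale c (tensor x w)"
    for c and x y w :: "'w forest \<Rightarrow>\<^sub>0 'k"
    by (rule lin_add [OF lin_tensor_left [OF lin_id]], rule lin_scale [OF lin_tensor_left [OF lin_id]])
  have basis: "tensor_shuffle (graft_left a (bvec p)) (graft_left b (bvec q)) =
     graft_left a (tensor_shuffle (bvec p) (graft_left b (bvec q))) +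
     graft_left b (tensor_shuffle (graft_left a (bvec p)) (bvec q)) +
     scale lam (graft_left (dot a b) (tensor_shuffle (bvec p) (bvec q)))"
    for p q :: "'w forest \<times> 'w forest"
    by (cases p; cases q)
      (simp add: graft_left_bvec tensor_shuffle_bvec shuffle_forest_trees add sc graft_left_tensor)
  show ?thesis
    by (rule lin_eqI [of _ _ P], intro lin_intros lin_tensor_shuffle, intro lin_intros lin_tensor_shuffle,
        rule lin_eqI [of _ _ Q], intro lin_intros lin_tensor_shuffle, intro lin_intros lin_tensor_shuffle, rule basis)
qed

text \<open>For two trees, the products of the two summands of \<open>E T\<close> and \<open>E t\<close> are expanded; the terms
  with \<open>\<emptyset>\<close> on the left are absorbed into \<open>E t\<close> and \<open>E T\<close> again, which gives the recursion of the shuffle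
  under \<open>graft_left\<close>. For forests, either both are trees, or one is empty and acts as a unit, or both
  sides are \<open>0\<close> because the shuffle has only non-connected terms.\<close>

lemma coproduct_ext_shuffle_basis:
  "coproduct_ext (tsh T t) = tensor_shuffle (coproduct_ext (bvec {#T#})) (coproduct_ext (bvec {#t#}))"
  "coproduct_ext (fsh F G) = tensor_shuffle (coproduct_ext (bvec F)) (coproduct_ext (bvec G))"
proof (induction T t and F G rule: shuffle_induct)
  case (1 a f b g)
  let ?T = "{#Node a f#}" and ?t = "{#Node b g#}"
  let ?E = "coproduct_ext :: ('w forest \<Rightarrow>\<^sub>0 'k) \<Rightarrow> _"
  let ?P = "?E (bvec f)" and ?Q = "?E (bvec g)"
  have T: "?E (bvec ?T) = graft_left a ?P + bvec ({#}, ?T)"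
    and t: "?E (bvec ?t) = graft_left b ?Q + bvec ({#}, ?t)"
    by (rule coproduct_ext_node)+
  have left: "tensor_shuffle P (?E (bvec ?t)) =
      tensor_shuffle P (graft_left b ?Q) + tensor_shuffle P (bvec ({#}, ?t))" for P
    unfolding t by (rule lin_add [OF lin_tensor_shuffle_right [OF lin_id]])
  have right: "tensor_shuffle (?E (bvec ?T)) Q =
      tensor_shuffle (graft_left a ?P) Q + tensor_shuffle (bvec ({#}, ?T)) Q" for Q
    unfolding T by (rule lin_add [OF lin_tensor_shuffle_left [OF lin_id]])
  have gadd: "graft_left c (x + y) = graft_left c x + graft_left c y"
    for c and x y :: "'w forest \<times> 'w forest \<Rightarrow>\<^sub>0 'k"
    by (rule lin_add [OF lin_graft_left [OF lin_id]])
  have "tensor_shuffle (?E (bvec ?T)) (?E (bvec ?t)) =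
      graft_left a (tensor_shuffle ?P (?E (bvec ?t))) +
      graft_left b (tensor_shuffle (?E (bvec ?T)) ?Q) +
      scale lam (graft_left (dot a b) (tensor_shuffle ?P ?Q)) +
      tensor (bvec {#}) (tsh (Node a f) (Node b g))"
    by (simp add: left right gadd tensor_shuffle_graft_left tensor_shuffle_graft_left_unit
        tensor_shuffle_unit_graft_left tensor_shuffle_bvec shuffle_forest_empty
        shuffle_forest_trees add_ac del: shuffle_tree.simps)
  moreover have "?E (tsh (Node a f) (Node b g)) =
      graft_left a (?E (fsh f ?t)) + graft_left b (?E (fsh ?T g)) +
      scale lam (graft_left (dot a b) (?E (fsh f g))) +
      tensor (bvec {#}) (tsh (Node a f) (Node b g))"
    by (simp add: lin_add [OF lin_coproduct_ext [OF lin_id]] lin_scale [OF lin_coproduct_ext [OF lin_id]]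
        lin_add [OF lin_tensor_right [OF lin_id]] lin_scale [OF lin_tensor_right [OF lin_id]]
        coproduct_ext_Bplus scale_add add_ac)
  ultimately show ?case
    by (simp only: 1)
next
  case (2 F G)
  consider "F = {#}" | "G = {#}" | T t where "F = {#T#}" "G = {#t#}"
    | "F \<noteq> {#}" "G \<noteq> {#}" "size F \<ge> 2 \<or> size G \<ge> 2"
    by (metis One_nat_def Suc_1 less_2_cases not_le size_1_singleton_mset size_eq_0_iff_empty)
  then show ?case
  proof cases
    case 3
    with 2 show ?thesis by (simp add: shuffle_forest_trees)
  next
    case 4
    have "coproduct_ext (fsh F G) = 0"
      using span_shuffle_forest [OF 4(1,2)]
    proof (rule lin_eqI_on [OF lin_coproduct_ext [OF lin_id] lin_const_zero])
      fix H :: "'w forest"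
      assume "H \<in> {H. size H + 1 = size F + size G}"
      moreover have "size F \<ge> 1" "size G \<ge> 1"
        using 4 by (simp_all add: Suc_le_eq nonempty_has_size)
      ultimately have "size H \<ge> 2" using 4(3) by auto
      then show "coproduct_ext (bvec H) = (0 :: _ \<Rightarrow>\<^sub>0 'k)" by (rule coproduct_ext_nonconnected)
    qed
    moreover have "coproduct_ext (bvec F :: _ \<Rightarrow>\<^sub>0 'k) = 0 \<or> coproduct_ext (bvec G :: _ \<Rightarrow>\<^sub>0 'k) = 0"
      using 4(3) coproduct_ext_nonconnected by blast
    ultimately show ?thesis
      using lin_zero [OF lin_tensor_shuffle_left [OF lin_id]]
        lin_zero [OF lin_tensor_shuffle_right [OF lin_id]] by auto
  qed (simp_all add: shuffle_forest_empty coproduct_ext_empty tensor_shuffle_unit)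
qed

lemma mult_map_bvec: "mult_map lsh (bvec (F, G)) = fsh F G"
  by (simp add: mult_map_def linext_single shuffle_bvec)

lemma lin_mult_map: "lin g \<Longrightarrow> lin (\<lambda>x. mult_map m (g x))"
  unfolding mult_map_def by (rule lin_linext_comp)

lemma lin_tau23: "lin g \<Longrightarrow> lin (\<lambda>x. tau23 (g x))"
  unfolding tau23_def by (rule lin_linext_comp)

lemma tau23_tensor_shuffle:
  "tensor_map (mult_map lsh) (mult_map lsh) (tau23 (tensor P Q)) = tensor_shuffle P Q"
proof -
  have basis: "tensor_map (mult_map lsh) (mult_map lsh) (tau23 (tensor (bvec p) (bvec q))) =
      tensor_shuffle (bvec p) (bvec q)" for p q
    by (cases p; cases q)
      (simp add: tensor_bvec tau23_def linext_single tensor_map_bvec mult_map_bvec tensor_shuffle_bvec)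
  show ?thesis
    by (rule lin_eqI [of _ _ P], intro lin_intros lin_tau23, intro lin_intros lin_tensor_shuffle,
        rule lin_eqI [of _ _ Q], intro lin_intros lin_tau23, intro lin_intros lin_tensor_shuffle, rule basis)
qed

lemma span_trees_shuffle:
  assumes "F \<in> trees" "G \<in> trees"
  shows "fsh F G \<in> span_on trees"
proof (cases "F = {#} \<or> G = {#}")
  case True
  then show ?thesis using assms by (auto simp: shuffle_forest_empty intro: span_bvec)
next
  case False
  then show ?thesis
    using assms by (intro span_mono [OF span_shuffle_forest]) (auto simp: trees_def)
qed

lemma counit_shuffle: "counit (lsh x y) = counit x * counit y"
proof -
  have basis: "Poly_Mapping.lookup (fsh F G) {#} = (if F = {#} then if G = {#} then 1 else 0 else 0)"
    for F G
  proof (cases "F = {#} \<or> G = {#}")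
    case True
    then show ?thesis by (auto simp: shuffle_forest_empty lookup_single when_def)
  next
    case False
    have "size F + size G \<noteq> 1" using False by (cases F; cases G) auto
    then show ?thesis
      using False span_shuffle_forest [of F G] by (auto simp: span_on_def in_keys_iff)
  qed
  have "Poly_Mapping.lookup (linext (fsh F) y) {#} =
      (if F = {#} then Poly_Mapping.lookup y {#} else 0)" for F
    by (simp add: lookup_linext basis in_keys_iff if_distrib [where f = "(*) _"] cong: if_cong)
  then show ?thesis
    unfolding counit_def shuffle_def
    by (simp add: lookup_linext [of _ x] in_keys_iff if_distrib [where f = "(*) _"] cong: if_cong)
qed

theorem left_counital_bialgebra_shuffle:
  "left_counital_bialgebra trees 1 lsh coproduct counit"
  unfolding single_one [symmetric, where 'a = "'w forest"]
proof
  let ?Y = "span_on trees :: ('w forest \<Rightarrow>\<^sub>0 'k) set"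
  fix x y :: "'w forest \<Rightarrow>\<^sub>0 'k" and z :: "'w forest \<times> 'w forest \<Rightarrow>\<^sub>0 'k"
  show "bvec {#} \<in> ?Y" by (simp add: span_bvec)
  show "lsh x y \<in> ?Y" if "x \<in> ?Y" "y \<in> ?Y"
    unfolding shuffle_def
    by (rule span_linext [OF that(1)], rule span_linext [OF that(2)]) (rule span_trees_shuffle)
  show "linear_on trees (\<lambda>x. lsh x y)" "linear_on trees (lsh x)"
    by (rule lin_linear_on [OF lin_shuffle_left [OF lin_id]],
        rule lin_linear_on [OF lin_shuffle_right [OF lin_id]])
  show "lsh (bvec {#}) x = x" "lsh x (bvec {#}) = x"
    by (simp_all add: shuffle_def linext_single shuffle_forest_empty linext_bvec_id
        shuffle_forest_empty(1) [abs_def])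
  show "coproduct x \<in> span_on (trees \<times> trees)" if "x \<in> ?Y"
    using that by (simp add: coproduct_eq_ext span_coproduct_ext)
  show "linear_on trees (coproduct :: ('w forest \<Rightarrow>\<^sub>0 'k) \<Rightarrow> _)"
    unfolding coproduct_def by (rule lin_linear_on [OF lin_linext])
  show "functional_on trees (counit :: ('w forest \<Rightarrow>\<^sub>0 'k) \<Rightarrow> _)"
    by (simp add: functional_on_def counit_def lookup_add)
  show "tensor_assoc (tensor_map coproduct id (coproduct x)) = tensor_map id coproduct (coproduct x)"
    if "x \<in> ?Y"
  proof -
    have "tensor_map coproduct id P = tensor_map coproduct_ext id P"
      "tensor_map id coproduct P = tensor_map id coproduct_ext P"
      if "P \<in> span_on (trees \<times> trees)" for P :: "'w forest \<times> 'w forest \<Rightarrow>\<^sub>0 'k"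
      unfolding tensor_map_def
      by (rule linext_cong [OF that], force simp: coproduct_eq_ext span_bvec)+
    then show ?thesis
      using that by (simp add: coproduct_eq_ext span_coproduct_ext coassociative_coproduct_ext)
  qed
  show "form_tensor_id counit (coproduct x) = x" if "x \<in> ?Y"
    using that by (simp add: coproduct_eq_ext left_counit_coproduct_ext)
  show "coproduct (mult_map lsh z) =
      tensor_map (mult_map lsh) (mult_map lsh) (tau23 (tensor_map coproduct coproduct z))"
    if "z \<in> span_on (trees \<times> trees)"
  proof (rule lin_eqI_on [OF _ _ that])
    show "lin (\<lambda>z. coproduct (mult_map lsh z))"
      unfolding coproduct_def by (intro lin_linext_comp lin_mult_map lin_id)
    show "lin (\<lambda>z. tensor_map (mult_map lsh) (mult_map lsh) (tau23 (tensor_map coproduct coproduct z)))"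
      by (intro lin_intros lin_tau23)
    fix b :: "'w forest \<times> 'w forest"
    assume "b \<in> trees \<times> trees"
    then obtain F G where "b = (F, G)" "F \<in> trees" "G \<in> trees" by blast
    then show "coproduct (mult_map lsh (bvec b)) =
      tensor_map (mult_map lsh) (mult_map lsh) (tau23 (tensor_map coproduct coproduct (bvec b)))"
      by (simp add: mult_map_bvec tensor_map_bvec [of coproduct coproduct] tau23_tensor_shuffle
          coproduct_eq_ext span_bvec span_trees_shuffle coproduct_ext_shuffle_basis)
  qed
  show "coproduct (bvec {#} :: _ \<Rightarrow>\<^sub>0 'k) = tensor (bvec {#}) (bvec {#})"
    by (simp add: coproduct_eq_ext span_bvec coproduct_ext_empty tensor_bvec)
  show "counit (lsh x y) = counit x * counit y"
    by (rule counit_shuffle)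
  show "counit (bvec {#} :: _ \<Rightarrow>\<^sub>0 'k) = 1"
    by (simp add: counit_bvec)
qed

lemma commutative_shuffle:
  assumes "lam \<noteq> 0 \<longrightarrow> abel_semigroup dot"
  shows "lsh x y = lsh y x"
  by (rule lin_eqI [of _ _ x], intro lin_shuffle, intro lin_shuffle,
      rule lin_eqI [of _ _ y], intro lin_shuffle, intro lin_shuffle)
    (simp add: shuffle_bvec shuffle_commute_basis(2) [OF assms])

section \<open>Failure of associativity\<close>

lemma lookup_shuffle_forest:
  assumes "F \<noteq> {#}" "G \<noteq> {#}"
  shows "Poly_Mapping.lookup (fsh F G) K = 1 / of_nat (size F * size G) *
    (\<Sum>T\<in>#F. \<Sum>t\<in>#G. let R = (F - {#T#}) + (G - {#t#}) in
       if R \<subseteq># K then Poly_Mapping.lookup (tsh T t) (K - R) else 0)"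
  using assms by (simp add: shuffle_forest.simps lookup_sum_mset lookup_times_bvec Let_def)

lemma lookup_shuffle_forest_size:
  assumes "F \<noteq> {#}" "G \<noteq> {#}" "size K + 1 \<noteq> size F + size G"
  shows "Poly_Mapping.lookup (fsh F G) K = 0"
  using span_shuffle_forest [OF assms(1,2)] assms(3) by (auto simp: span_on_def in_keys_iff)

text \<open>All trees of \<open>F\<close> but one survive unchanged in each term of the shuffle (all of them if \<open>G\<close> is
  empty), so if two differ from \<open>u\<close>, every term contains a tree other than \<open>u\<close>.\<close>

lemma lookup_shuffle_replicate_zero:
  assumes "2 \<le> size {#s \<in># F. s \<noteq> u#}"
  shows "Poly_Mapping.lookup (fsh F G) (replicate_mset n u) = 0"
proof (cases "G = {#}")
  case True
  have "{#s \<in># replicate_mset n u. s \<noteq> u#} = {#}" by (induction n) auto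
  then have "F \<noteq> replicate_mset n u" using assms by (metis not_numeral_le_zero size_empty)
  then show ?thesis using True by (simp add: shuffle_forest_empty lookup_single when_def)
next
  case False
  have "F \<noteq> {#}" using assms by auto
  have "\<not> (F - {#T#}) + R \<subseteq># replicate_mset n u" if T: "T \<in># F" for T R
  proof
    assume sub: "(F - {#T#}) + R \<subseteq># replicate_mset n u"
    obtain F' where F': "F = add_mset T F'" using multi_member_split [OF T] by blast
    then have "1 \<le> size {#s \<in># F'. s \<noteq> u#}" using assms by (simp split: if_splits)
    then have "{#s \<in># F'. s \<noteq> u#} \<noteq> {#}" by (metis not_one_le_zero size_empty)
    then obtain s where "s \<in># {#s \<in># F'. s \<noteq> u#}" by (metis multiset_nonemptyE)
    then have "s \<in># F'" "s \<noteq> u" by simp_all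
    then show False
      using mset_subset_eqD [OF sub, of s] F' by (auto split: if_splits)
  qed
  then have "(\<Sum>T\<in>#F. \<Sum>t\<in>#G. let R = (F - {#T#}) + (G - {#t#}) in
       if R \<subseteq># replicate_mset n u
       then Poly_Mapping.lookup (tsh T t) (replicate_mset n u - R) else 0) = (\<Sum>T\<in>#F. 0)"
    by (intro arg_cong [where f = sum_mset] image_mset_cong) (simp add: Let_def)
  then show ?thesis
    using \<open>F \<noteq> {#}\<close> False by (simp add: lookup_shuffle_forest)
qed

lemma lookup_Bplus:
  "Poly_Mapping.lookup (Bplus b x :: 'w forest \<Rightarrow>\<^sub>0 'k) {#Node a U#} =
     (if b = a then Poly_Mapping.lookup x U else 0)"
  by (simp add: Bplus_def lookup_linext lookup_single when_def in_keys_iff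
      if_distrib [where f = "(*) _"] cong: if_cong)

lemma lookup_shuffle:
  "Poly_Mapping.lookup (lsh x (bvec G)) v =
     (\<Sum>F\<in>Poly_Mapping.keys x. Poly_Mapping.lookup x F * Poly_Mapping.lookup (fsh F G) v)"
  by (simp add: shuffle_def linext_single lookup_linext)

text \<open>Let \<open>p\<close> be a one-vertex tree, \<open>C\<close> the root with two leaves, and \<open>u\<close> the root with the single
  child \<open>C\<close>. The tree \<open>u\<close> has coefficient \<open>1\<close> in the shuffle of \<open>p\<close> and \<open>C\<close>: it arises only by grafting \<open>C\<close>
  below the vertex of \<open>p\<close>, since the other terms have two branches at the root. With \<open>k = m + 2\<close>, the
  forest \<open>f\<close> consists of \<open>C\<close>, \<open>p\<close> and \<open>m\<close> copies of \<open>u\<close>, and the associator of \<open>x = B\<^sub>+ f\<close>, \<open>p\<close> and \<open>C\<close> is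
  examined at the tree with branches \<open>U = u\<^sup>k\<close>. The bound \<open>k \<ge> 3\<close> excludes by their number of branches
  the terms in which the root of \<open>x\<close> is not part of the root of the result.\<close>

lemma not_associative: "\<not> associative_on trees lsh"
proof
  assume assoc: "associative_on trees lsh"
  obtain m where m: "m \<ge> 1" and k: "of_nat (m + 2) \<noteq> (0 :: 'k)"
  proof (cases "(of_nat 3 :: 'k) = 0")
    case True
    have "of_nat 4 = (of_nat 3 :: 'k) + 1"
      by (metis of_nat_Suc add.commute eval_nat_numeral(2) semiring_norm(26,27) numeral_eq_Suc)
    with True have "of_nat (2 + 2) \<noteq> (0 :: 'k)" by simp
    then show ?thesis using that [of 2] by simp
  next
    case False
    then show ?thesis using that [of 1] by (simp add: numeral_3_eq_3)
  qed
  fix a :: 'w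
  define p where "p = Node a {#}"
  define C where "C = Node a {#p, p#}"
  define u where "u = Node a {#C#}"
  define f where "f = add_mset C (add_mset p (replicate_mset m u))"
  define K where "K = add_mset p (replicate_mset (Suc m) u)"
  define U where "U = replicate_mset (m + 2) u"
  define x where "x = Node a f"
  have ne [simp]: "p \<noteq> C" "C \<noteq> p" "p \<noteq> u" "u \<noteq> p" "C \<noteq> u" "u \<noteq> C"
    by (auto simp: p_def C_def u_def)
  have Cp: "Poly_Mapping.lookup (tsh C p) {#u#} = 1"
    by (simp add: C_def p_def u_def lookup_add lookup_Bplus shuffle_forest_empty
        lookup_shuffle_forest_size lookup_single when_def)
  have pC: "Poly_Mapping.lookup (tsh p C) {#u#} = 1"
    by (simp add: C_def p_def u_def lookup_add lookup_Bplus shuffle_forest_empty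
        lookup_shuffle_forest_size lookup_single when_def)
  have pp: "Poly_Mapping.lookup (tsh p p) {#u#} = 0"
    by (simp only: C_def p_def u_def shuffle_tree.simps shuffle_forest_empty lookup_add lookup_scale
        lookup_Bplus) (simp add: lookup_single when_def)
  \<comment> \<open>\<open>K\<close> arises only by turning \<open>C\<close> into \<open>u\<close>: in any other term \<open>C\<close> is still present.\<close>
  have fK: "Poly_Mapping.lookup (fsh f {#p#}) K = 1 / of_nat (m + 2)"
  proof -
    have "\<not> add_mset C R \<subseteq># K" for R
      using mset_subset_eqD [of "add_mset C R" K C] by (auto simp: K_def split: if_splits)
    then show ?thesis
      using Cp by (subst lookup_shuffle_forest)
        (simp_all add: f_def K_def Let_def diff_add_mset_swap)
  qed
  \<comment> \<open>Of \<open>K\<close>, the tree \<open>p\<close> has to be turned into \<open>u\<close>.\<close>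
  have KU: "Poly_Mapping.lookup (fsh K {#C#}) U = 1 / of_nat (m + 2)"
  proof -
    have "\<not> add_mset p R \<subseteq># U" for R
      using mset_subset_eqD [of "add_mset p R" U p] by (auto simp: U_def split: if_splits)
    then show ?thesis
      using pC by (subst lookup_shuffle_forest)
        (simp_all add: U_def K_def Let_def diff_add_mset_swap)
  qed
  \<comment> \<open>All other terms are too far from \<open>U\<close> for a second shuffle with one tree; here \<open>p\<close> shuffled
    with itself must not give \<open>u\<close>.\<close>
  have keys: "fsh f {#p#} \<in> span_on (insert K {H. 2 \<le> size {#s \<in># H. s \<noteq> u#}})"
    (is "_ \<in> span_on ?S")
  proof -
    have "tsh C p * bvec (f - {#C#}) \<in> span_on ?S"
    proof (rule span_times_bvec [OF span_shuffle_tree])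
      fix H :: "'w forest"
      assume "H \<in> {H. size H = 1}"
      then obtain s where "H = {#s#}" using size_1_singleton_mset by blast
      then show "H + (f - {#C#}) \<in> ?S"
        by (cases "s = u") (simp_all add: f_def K_def)
    qed
    moreover have "tsh p p * bvec (f - {#p#}) \<in> span_on ?S"
    proof (rule span_times_bvec)
      show "tsh p p \<in> span_on {H. size H = 1 \<and> H \<noteq> {#u#}}"
        using span_shuffle_tree [of p p] pp by (auto simp: span_on_def in_keys_iff)
      fix H :: "'w forest"
      assume H: "H \<in> {H. size H = 1 \<and> H \<noteq> {#u#}}"
      then obtain s where "H = {#s#}" using size_1_singleton_mset by blast
      with H show "H + (f - {#p#}) \<in> ?S"
        by (simp add: f_def)
    qed
    moreover have "tsh u p * bvec (f - {#u#}) \<in> span_on ?S"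
      by (rule span_times_bvec [OF span_UNIV]) (simp add: f_def diff_add_mset_swap)
    moreover have "T = C \<or> T = p \<or> T = u" if "T \<in># f" for T
      using that by (auto simp: f_def split: if_splits)
    ultimately have "tsh T p * bvec (f - {#T#}) \<in> span_on ?S" if "T \<in># f" for T
      using that by blast
    moreover have "f \<noteq> {#}" by (simp add: f_def)
    ultimately show ?thesis
      by (simp add: shuffle_forest.simps span_scale span_sum_mset)
  qed
  have size_f: "size f = m + 2" "f \<noteq> {#}"
    by (simp_all add: f_def)
  have f_zero: "Poly_Mapping.lookup (fsh f G) U = 0" for G
    unfolding U_def by (rule lookup_shuffle_replicate_zero) (simp add: f_def)
  have size_U: "size U = m + 2" by (simp add: U_def)
  have top: "Poly_Mapping.lookup (lsh (fsh f {#p#}) (bvec {#C#})) U = (1 / of_nat (m + 2)) ^ 2"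
  proof -
    have "Poly_Mapping.lookup (fsh f {#p#}) H * Poly_Mapping.lookup (fsh H {#C#}) U =
        (if H = K then (1 / of_nat (m + 2)) ^ 2 else 0)"
      if "H \<in> Poly_Mapping.keys (fsh f {#p#})" for H
    proof (cases "H = K")
      case True
      then show ?thesis by (simp only: fK KU power2_eq_square if_True simp_thms)
    next
      case False
      then have "2 \<le> size {#s \<in># H. s \<noteq> u#}"
        using that keys by (auto simp: span_on_def)
      then show ?thesis
        using False by (simp only: U_def lookup_shuffle_replicate_zero mult_zero_right if_False simp_thms)
    qed
    moreover have "K \<in> Poly_Mapping.keys (fsh f {#p#})"
      using fK k by (simp add: in_keys_iff)
    ultimately show ?thesis
      by (simp add: lookup_shuffle)
  qed
  \<comment> \<open>With \<open>C\<close> as the second factor and \<open>F\<close> below the root of the first, the terms rooted at \<open>C\<close> have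
    two branches, and those with merged roots have \<open>size F + 1\<close> branches.\<close>
  have left_node: "Poly_Mapping.lookup (lsh (Bplus b X) (bvec {#C#})) {#Node a U#} =
      (if b = a then Poly_Mapping.lookup (lsh X (bvec {#C#})) U else 0)"
    if X: "X \<in> span_on {F. F \<noteq> {#} \<and> size F \<noteq> m + 1}" for b X
  proof -
    have "Poly_Mapping.lookup (tsh (Node b F) C) {#Node a U#} =
        (if b = a then Poly_Mapping.lookup (fsh F {#C#}) U else 0)"
      if "F \<noteq> {#}" "size F \<noteq> m + 1" for F
      using that m size_U
      by (auto simp: C_def lookup_add lookup_Bplus lookup_shuffle_forest_size)
    moreover have "lsh (Bplus b X) (bvec {#C#}) = linext (\<lambda>F. tsh (Node b F) C) X"
      by (subst lin_eq_linext [where f = "\<lambda>X. lsh (Bplus b X) (bvec {#C#})"])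
        (auto intro!: lin_shuffle lin_Bplus simp: Bplus_bvec shuffle_bvec shuffle_forest_trees)
    ultimately show ?thesis
      using X by (auto simp: lookup_linext lookup_shuffle span_on_def intro!: sum.cong sum.neutral)
  qed
  \<comment> \<open>Terms whose root comes from \<open>x\<close>, alone or merged, keep a branch other than \<open>u\<close>; those rooted at
    the second factor have at most two branches.\<close>
  have right_node: "Poly_Mapping.lookup (lsh (bvec {#x#}) (Bplus d Y)) {#Node a U#} = 0"
    if Y: "Y \<in> span_on {h. h \<noteq> {#} \<and> size h \<le> 2}" for d Y
  proof -
    have "Poly_Mapping.lookup (tsh x (Node d h)) {#Node a U#} = 0"
      if "h \<noteq> {#}" "size h \<le> 2" for h
      using that m size_U
      by (auto simp: x_def lookup_add lookup_Bplus lookup_shuffle_forest_size f_zero)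
    moreover have "lsh (bvec {#x#}) (Bplus d Y) = linext (\<lambda>h. tsh x (Node d h)) Y"
      by (subst lin_eq_linext [where f = "\<lambda>Y. lsh (bvec {#x#}) (Bplus d Y)"])
        (auto intro!: lin_shuffle lin_Bplus simp: Bplus_bvec shuffle_bvec shuffle_forest_trees)
    ultimately show ?thesis
      using Y by (auto simp: lookup_linext span_on_def intro!: sum.neutral)
  qed
  have "Poly_Mapping.lookup (lsh (lsh (bvec {#x#}) (bvec {#p#})) (bvec {#C#})) {#Node a U#} =
      (1 / of_nat (m + 2)) ^ 2"
  proof -
    have "lsh (bvec {#x#}) (bvec {#p#}) = Bplus a (fsh f {#p#}) + Bplus a (bvec {#x#}) +
        scale lam (Bplus (dot a a) (bvec f))"
      by (simp add: shuffle_bvec shuffle_forest_trees x_def p_def shuffle_forest_empty)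
    then have "lsh (lsh (bvec {#x#}) (bvec {#p#})) (bvec {#C#}) =
        lsh (Bplus a (fsh f {#p#})) (bvec {#C#}) + lsh (Bplus a (bvec {#x#})) (bvec {#C#}) +
        scale lam (lsh (Bplus (dot a a) (bvec f)) (bvec {#C#}))"
      by (simp add: lin_add [OF lin_shuffle_left [OF lin_id]] lin_scale [OF lin_shuffle_left [OF lin_id]])
    moreover have "fsh f {#p#} \<in> span_on {F. F \<noteq> {#} \<and> size F \<noteq> m + 1}"
      by (rule span_mono [OF span_shuffle_forest]) (auto simp: size_f)
    moreover have "Poly_Mapping.lookup (fsh {#x#} {#C#}) U = 0"
      by (rule lookup_shuffle_forest_size) (auto simp: size_U)
    ultimately show ?thesis
      using m by (simp add: lookup_add left_node span_bvec size_f top shuffle_bvec f_zero)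
  qed
  moreover have "Poly_Mapping.lookup (lsh (bvec {#x#}) (lsh (bvec {#p#}) (bvec {#C#}))) {#Node a U#} = 0"
  proof -
    have "lsh (bvec {#p#}) (bvec {#C#}) = Bplus a (bvec {#C#}) + Bplus a (fsh {#p#} {#p, p#}) +
        scale lam (Bplus (dot a a) (bvec {#p, p#}))"
      by (simp add: shuffle_bvec shuffle_forest_trees C_def p_def shuffle_forest_empty)
    moreover have "fsh {#p#} {#p, p#} \<in> span_on {h. h \<noteq> {#} \<and> size h \<le> 2}"
      by (rule span_mono [OF span_shuffle_forest]) auto
    ultimately show ?thesis
      by (simp add: lin_add [OF lin_shuffle_right [OF lin_id]] lin_scale [OF lin_shuffle_right [OF lin_id]]
          lookup_add right_node span_bvec)
  qed
  moreover have "lsh (lsh (bvec {#x#}) (bvec {#p#})) (bvec {#C#}) =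
      lsh (bvec {#x#}) (lsh (bvec {#p#}) (bvec {#C#}))"
    using assoc unfolding associative_on_def by (simp add: span_bvec)
  ultimately show False
    using k by simp
qed

end

lemma not_cocommutative:
  "\<not> cocommutative_on trees (coproduct :: ('w forest \<Rightarrow>\<^sub>0 'k::field) \<Rightarrow> _)"
proof
  fix a :: 'w
  let ?f = "{#Node a {#}, Node a {#}#}"
  let ?x = "bvec {#Node a ?f#} :: 'w forest \<Rightarrow>\<^sub>0 'k"
  assume "cocommutative_on trees (coproduct :: ('w forest \<Rightarrow>\<^sub>0 'k) \<Rightarrow> _)"
  then have "tensor_flip (coproduct ?x) = coproduct ?x"
    unfolding cocommutative_on_def by (simp add: span_bvec)
  then have "bvec ({#Node a ?f#}, {#}) = (bvec ({#}, {#Node a ?f#}) :: _ \<Rightarrow>\<^sub>0 'k)"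
    by (simp add: coproduct_branching tensor_flip_def linext_single)
  from arg_cong [OF this, of Poly_Mapping.keys] show False by simp
qed

theorem theorem1p8:
  fixes dot :: "'w \<Rightarrow> 'w \<Rightarrow> 'w" and lam :: "'k::field"
  assumes "lam \<noteq> 0 \<longrightarrow> abel_semigroup dot"
  shows "left_counital_bialgebra trees 1 (shuffle dot lam) coproduct counit \<and>
    commutative_on trees (shuffle dot lam) \<and>
    \<not> associative_on trees (shuffle dot lam) \<and>
    \<not> cocommutative_on trees (coproduct :: ('w forest \<Rightarrow>\<^sub>0 'k) \<Rightarrow> _)"
  using left_counital_bialgebra_shuffle not_associative not_cocommutative
    commutative_shuffle [OF assms]
  by (auto simp: commutative_on_def)

end
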